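(* For any finite graph $G$, regarded as a one-dimensional simplicial complex, we have $\mathrm{scat}\,G=\mathrm{gscat}\,G=\Upsilon(G)-1$.
   Context: Graphs are simple and nonempty, and are regarded as abstract simplicial complexes of dimension at most one; subgraphs are subcomplexes. Two simplicial maps $\varphi,\psi\colon K\to L$ between abstract simplicial complexes are contiguous, $\varphi\sim_c\psi$, if for every simplex $\sigma$ of $K$ the set of vertices $\varphi(\sigma)\cup\psi(\sigma)$ is a simplex of $L$. They are in the same contiguity class, $\varphi\sim\psi$, if there is a finite sequence of simplicial maps $\varphi=\varphi_1\sim_c\varphi_2\sim_c\cdots\sim_c\varphi_m=\psi$ from $K$ to $L$. A subcomplex $U\subset K$ is categorical (in $K$) if there is a vertex $v\in K$ such that the inclusion $U\to K$ and the constant map $c_v\colon U\to K$ with value $v$ are in the same contiguity class. The simplicial LS-category $\mathrm{scat}\,K$ is the least integer $n\geq 0$ such that $K=U_0\cup\cdots\cup U_n$ for some $n+1$ categorical subcomplexes of $K$. The geometric simplicial category $\mathrm{gscat}\,K$ is the least integer $n\geq 0$ such that $K$ is a union of $n+1$ subcomplexes $U_0,\dots,U_n$ each of which is strongly collapsible in itself, i.e. the identity $1_{U_j}\colon U_j\to U_j$ is in the same contiguity class as a constant map $U_j\to U_j$. A cycle in a graph is an alternating sequence $v_0,e_1,v_1,\dots,v_{n-1},e_n,v_n$ of vertices and edges, distinct except that $v_0=v_n$, where the incident vertices of each edge $e_i$ are $v_{i-1}$ and $v_i$. A forest is a graph without cycles. The arboricity $\Upsilon(G)$ is the minimum number of edge-disjoint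 spanning forests into which $G$ can be decomposed; a spanning forest is an acyclic subgraph, not necessarily connected, containing all the vertices of $G$.
   Formalization: The finite graph G is assumed connected; for disconnected graphs the equality fails with the given definitions (two isolated vertices have scat = gscat = 1 but arboricity minus 1 equal to 0). *)

theory Defs
  imports Main
begin

text \<open>
  An abstract simplicial complex is represented by its set of (nonempty, finite) simplices.
\<close>

definition simplicial_complex :: "'a set set \<Rightarrow> bool" where
  "simplicial_complex K \<longleftrightarrow>
     (\<forall>\<sigma>\<in>K. finite \<sigma> \<and> \<sigma> \<noteq> {} \<and> (\<forall>\<tau>. \<tau> \<subseteq> \<sigma> \<and> \<tau> \<noteq> {} \<longrightarrow> \<tau> \<in> K))"

definition vertices :: "'a set set \<Rightarrow> 'a set" where
  "vertices K = \<Union>K"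

definition subcomplex :: "'a set set \<Rightarrow> 'a set set \<Rightarrow> bool" where
  "subcomplex U K \<longleftrightarrow> simplicial_complex U \<and> U \<subseteq> K"

text \<open>
  A simplicial map is a total HOL function of which only the values on the vertices of the
  source matter. Simplicial maps that agree on the vertices are contiguous, so the values
  elsewhere have no influence on contiguity classes.
\<close>

definition simplicial_map :: "'a set set \<Rightarrow> 'b set set \<Rightarrow> ('a \<Rightarrow> 'b) \<Rightarrow> bool" where
  "simplicial_map K L \<phi> \<longleftrightarrow> (\<forall>\<sigma>\<in>K. \<phi> ` \<sigma> \<in> L)"

definition contiguous :: "'a set set \<Rightarrow> 'b set set \<Rightarrow> ('a \<Rightarrow> 'b) \<Rightarrow> ('a \<Rightarrow> 'b) \<Rightarrow> bool" where
  "contiguous K L \<phi> \<psi> \<longleftrightarrow>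
     simplicial_map K L \<phi> \<and> simplicial_map K L \<psi> \<and> (\<forall>\<sigma>\<in>K. \<phi> ` \<sigma> \<union> \<psi> ` \<sigma> \<in> L)"

definition same_contiguity_class ::
    "'a set set \<Rightarrow> 'b set set \<Rightarrow> ('a \<Rightarrow> 'b) \<Rightarrow> ('a \<Rightarrow> 'b) \<Rightarrow> bool" where
  "same_contiguity_class K L \<phi> \<psi> \<longleftrightarrow>
     simplicial_map K L \<phi> \<and> simplicial_map K L \<psi> \<and> (contiguous K L)\<^sup>*\<^sup>* \<phi> \<psi>"

definition categorical :: "'a set set \<Rightarrow> 'a set set \<Rightarrow> bool" where
  "categorical K U \<longleftrightarrow>
     subcomplex U K \<and> (\<exists>v\<in>vertices K. same_contiguity_class U K (\<lambda>x. x) (\<lambda>_. v))"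

definition strongly_collapsible :: "'a set set \<Rightarrow> bool" where
  "strongly_collapsible U \<longleftrightarrow>
     (\<exists>v\<in>vertices U. same_contiguity_class U U (\<lambda>x. x) (\<lambda>_. v))"

text \<open>
  The three minima below are attained for every finite nonempty complex (respectively graph);
  when no cover exists the value of \<open>LEAST\<close> is unspecified.
\<close>

definition scat :: "'a set set \<Rightarrow> nat" where
  "scat K = (LEAST n. \<exists>U :: nat \<Rightarrow> 'a set set.
     (\<forall>i\<le>n. categorical K (U i)) \<and> K = (\<Union>i\<le>n. U i))"

definition gscat :: "'a set set \<Rightarrow> nat" where
  "gscat K = (LEAST n. \<exists>U :: nat \<Rightarrow> 'a set set.
     (\<forall>i\<le>n. subcomplex (U i) K \<and> strongly_collapsible (U i)) \<and> K = (\<Union>i\<le>n. U i))"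

definition graph :: "'a set set \<Rightarrow> bool" where
  "graph G \<longleftrightarrow> simplicial_complex G \<and> G \<noteq> {} \<and> (\<forall>\<sigma>\<in>G. card \<sigma> \<le> 2)"

definition edges :: "'a set set \<Rightarrow> 'a set set" where
  "edges G = {e \<in> G. card e = 2}"

text \<open>
  The cycle with vertices \<open>v 0, ..., v n\<close> and edges \<open>e 1, ..., e n\<close>. The one-term
  sequence \<open>v 0\<close> is not a cycle, hence \<open>n \<ge> 1\<close>; as the edges are distinct
  two-element sets, \<open>n \<ge> 3\<close> follows.
\<close>

definition cycle :: "'a set set \<Rightarrow> nat \<Rightarrow> (nat \<Rightarrow> 'a) \<Rightarrow> (nat \<Rightarrow> 'a set) \<Rightarrow> bool" where
  "cycle G n v e \<longleftrightarrow>
     n \<ge> 1 \<and> v 0 = v n \<and> inj_on v {0..<n} \<and> inj_on e {1..n} \<and>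
     (\<forall>i\<in>{0..n}. v i \<in> vertices G) \<and>
     (\<forall>i\<in>{1..n}. e i \<in> edges G \<and> e i = {v (i - 1), v i})"

definition forest :: "'a set set \<Rightarrow> bool" where
  "forest F \<longleftrightarrow> graph F \<and> \<not> (\<exists>n v e. cycle F n v e)"

definition spanning_forest :: "'a set set \<Rightarrow> 'a set set \<Rightarrow> bool" where
  "spanning_forest F G \<longleftrightarrow> subcomplex F G \<and> forest F \<and> vertices F = vertices G"

definition arboricity :: "'a set set \<Rightarrow> nat" where
  "arboricity G = (LEAST k. \<exists>F :: nat \<Rightarrow> 'a set set.
     (\<forall>i<k. spanning_forest (F i) G) \<and>
     (\<forall>i<k. \<forall>j<k. i \<noteq> j \<longrightarrow> edges (F i) \<inter> edges (F j) = {}) \<and>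
     G = (\<Union>i<k. F i))"

text \<open>
  A categorical or strongly collapsible subcomplex lies in a single connected component,
  whereas a spanning forest need not. So comparing \<open>scat\<close> and \<open>gscat\<close> with the arboricity
  needs connectedness: two isolated vertices have \<open>scat = gscat = 1\<close> and arboricity 1.
\<close>

definition connected_complex :: "'a set set \<Rightarrow> bool" where
  "connected_complex K \<longleftrightarrow>
     (\<forall>u\<in>vertices K. \<forall>w\<in>vertices K. (\<lambda>x y. {x, y} \<in> K)\<^sup>*\<^sup>* u w)"

end

theory Submission
  imports Defs
begin

text \<open>
  On a cycle of a graph the inclusion is rigid: a map contiguous to it must send a vertex of the
  cycle into both cycle edges at that vertex, hence fix it. So a categorical subcomplex contains no
  cycle, and a categorical cover becomes a decomposition into spanning forests once each edge is
  assigned to one member of the cover. Conversely, in a connected graph every spanning forest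
  extends to a spanning tree, and a tree is strongly collapsible because attaching a leaf preserves
  strong collapsibility.
\<close>

section \<open>Simplices and vertices\<close>

lemma simplicial_complex_subset:
  "simplicial_complex K \<Longrightarrow> \<sigma> \<in> K \<Longrightarrow> \<tau> \<subseteq> \<sigma> \<Longrightarrow> \<tau> \<noteq> {} \<Longrightarrow> \<tau> \<in> K"
  unfolding simplicial_complex_def by blast

lemma simplex_finite_nonempty:
  "simplicial_complex K \<Longrightarrow> \<sigma> \<in> K \<Longrightarrow> finite \<sigma> \<and> \<sigma> \<noteq> {}"
  unfolding simplicial_complex_def by blast

lemma singleton_in_complex:
  "simplicial_complex K \<Longrightarrow> x \<in> vertices K \<Longrightarrow> {x} \<in> K"
  by (metis UnionE empty_subsetI insert_not_empty insert_subset simplicial_complex_subset vertices_def)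

lemma vertices_mono: "K \<subseteq> L \<Longrightarrow> vertices K \<subseteq> vertices L"
  by (auto simp: vertices_def)

lemma simplex_cases:
  assumes "graph G" and "\<sigma> \<in> G"
  obtains x where "\<sigma> = {x}" | x y where "x \<noteq> y" and "\<sigma> = {x, y}"
proof -
  have "finite \<sigma>" "\<sigma> \<noteq> {}" "card \<sigma> \<le> 2"
    using assms simplex_finite_nonempty[of G \<sigma>] by (auto simp: graph_def)
  then have "card \<sigma> = 1 \<or> card \<sigma> = 2"
    by (metis One_nat_def Suc_1 card_0_eq le_SucE le_zero_eq)
  then show thesis
    using that by (auto simp: card_1_singleton_iff card_2_iff)
qed

subsection \<open>Contiguity\<close>

lemma contiguous_codomain_mono:
  "contiguous K L \<phi> \<psi> \<Longrightarrow> L \<subseteq> M \<Longrightarrow> contiguous K M \<phi> \<psi>"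
  by (auto simp: contiguous_def simplicial_map_def)

lemma same_contiguity_class_codomain_mono:
  assumes "same_contiguity_class K L \<phi> \<psi>" and "L \<subseteq> M"
  shows "same_contiguity_class K M \<phi> \<psi>"
proof -
  have "(contiguous K L)\<^sup>*\<^sup>* \<le> (contiguous K M)\<^sup>*\<^sup>*"
    using assms(2) by (intro rtranclp_mono) (auto intro: contiguous_codomain_mono)
  with assms show ?thesis
    by (auto simp: same_contiguity_class_def simplicial_map_def)
qed

lemma contiguous_comp:
  assumes "contiguous K L \<phi> \<psi>" and "simplicial_map J K r"
  shows "contiguous J L (\<phi> \<circ> r) (\<psi> \<circ> r)"
  using assms unfolding contiguous_def simplicial_map_def image_comp[symmetric] by blast

lemma rtranclp_contiguous_comp:
  assumes "(contiguous K L)\<^sup>*\<^sup>* \<phi> \<psi>" and "simplicial_map J K r"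
  shows "(contiguous J L)\<^sup>*\<^sup>* (\<phi> \<circ> r) (\<psi> \<circ> r)"
  using assms(1)
proof (induction rule: rtranclp_induct)
  case (step \<chi> \<psi>)
  have "contiguous J L (\<chi> \<circ> r) (\<psi> \<circ> r)"
    using step.hyps(2) assms(2) by (rule contiguous_comp)
  with step.IH show ?case
    by (rule rtranclp.rtrancl_into_rtrancl[of "contiguous J L"])
qed simp

section \<open>Strong collapsibility\<close>

lemma strongly_collapsible_imp_categorical:
  assumes "subcomplex U K" and "strongly_collapsible U"
  shows "categorical K U"
  using assms vertices_mono[of U K]
  by (auto simp: categorical_def strongly_collapsible_def subcomplex_def
      intro: same_contiguity_class_codomain_mono)

lemma subcomplex_full_simplex:
  assumes "simplicial_complex K" and "\<sigma> \<in> K"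
  shows "subcomplex (Pow \<sigma> - {{}}) K"
  unfolding subcomplex_def
proof
  show "simplicial_complex (Pow \<sigma> - {{}})"
    using simplex_finite_nonempty[OF assms] unfolding simplicial_complex_def
    by (blast intro: finite_subset)
  show "Pow \<sigma> - {{}} \<subseteq> K"
    using simplicial_complex_subset[OF assms] by blast
qed

text \<open>Any two maps into a full simplex are contiguous, so one step leads from the identity to
  a constant.\<close>

lemma full_simplex_strongly_collapsible:
  assumes "\<sigma> \<noteq> {}"
  shows "strongly_collapsible (Pow \<sigma> - {{}})"
proof -
  let ?U = "Pow \<sigma> - {{}}"
  obtain v where v: "v \<in> \<sigma>" using assms by blast
  then have "contiguous ?U ?U (\<lambda>x. x) (\<lambda>_. v)"
    by (auto simp: contiguous_def simplicial_map_def)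
  moreover from this have "same_contiguity_class ?U ?U (\<lambda>x. x) (\<lambda>_. v)"
    unfolding same_contiguity_class_def by (simp add: contiguous_def r_into_rtranclp)
  moreover have "v \<in> vertices ?U"
    using v by (auto simp: vertices_def)
  ultimately show ?thesis
    by (auto simp: strongly_collapsible_def)
qed

text \<open>Folding the leaf \<open>y\<close> onto its neighbour \<open>x\<close> is a retraction
  contiguous to the identity. Followed by the chain that contracts \<open>T\<close>, it contracts
  the whole complex.\<close>

lemma strongly_collapsible_add_leaf:
  assumes T: "simplicial_complex T" "strongly_collapsible T"
    and x: "x \<in> vertices T" and y: "y \<notin> vertices T"
  shows "strongly_collapsible (T \<union> {{y}, {x, y}})"
proof -
  let ?T = "T \<union> {{y}, {x, y}}"
  let ?r = "(\<lambda>z. z)(y := x)"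
  obtain v where v: "v \<in> vertices T" "(contiguous T T)\<^sup>*\<^sup>* (\<lambda>x. x) (\<lambda>_. v)"
    using T(2) by (auto simp: strongly_collapsible_def same_contiguity_class_def)
  have r_T: "?r ` \<sigma> = \<sigma>" if "\<sigma> \<in> T" for \<sigma>
  proof -
    have "y \<notin> \<sigma>" using that y by (auto simp: vertices_def)
    then show ?thesis by auto
  qed
  have xT: "{x} \<in> T" and vT: "{v} \<in> T"
    using singleton_in_complex[OF T(1)] x v(1) by auto
  have r: "simplicial_map ?T T ?r"
    unfolding simplicial_map_def
  proof
    fix \<sigma> assume "\<sigma> \<in> ?T"
    then consider "\<sigma> \<in> T" | "?r ` \<sigma> = {x}" by force
    then show "?r ` \<sigma> \<in> T"
      using r_T xT by cases metis+
  qed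
  have ne: "\<sigma> \<noteq> {}" if "\<sigma> \<in> ?T" for \<sigma>
    using that simplex_finite_nonempty[OF T(1)] by auto
  have id_map: "simplicial_map ?T ?T (\<lambda>z. z)"
    by (auto simp: simplicial_map_def)
  have const_map: "simplicial_map ?T ?T (\<lambda>_. v)"
    using ne vT by (auto simp: simplicial_map_def image_constant_conv)
  have "\<sigma> \<union> ?r ` \<sigma> \<in> ?T" if "\<sigma> \<in> ?T" for \<sigma>
    using that
  proof
    assume "\<sigma> \<in> T"
    then show ?thesis using r_T[of \<sigma>] by simp
  next
    assume "\<sigma> \<in> {{y}, {x, y}}"
    then have "\<sigma> \<union> ?r ` \<sigma> = {x, y}" by auto
    then show ?thesis by blast
  qed
  then have "contiguous ?T ?T (\<lambda>z. z) ?r"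
    using r id_map by (auto simp: contiguous_def simplicial_map_def)
  \<comment> \<open>Composed with \<open>?r\<close>, the chain from the identity to a constant
    starts at \<open>?r\<close> itself and keeps its constant end.\<close>
  moreover have "(contiguous ?T T)\<^sup>*\<^sup>* ?r (\<lambda>_. v)"
    using rtranclp_contiguous_comp[OF v(2) r] by (simp only: comp_def)
  then have "(contiguous ?T ?T)\<^sup>*\<^sup>* ?r (\<lambda>_. v)"
    by (rule rtranclp_mono[THEN predicate2D, rotated])
      (auto intro: contiguous_codomain_mono)
  ultimately have "(contiguous ?T ?T)\<^sup>*\<^sup>* (\<lambda>z. z) (\<lambda>_. v)"
    by (rule converse_rtranclp_into_rtranclp)
  then show ?thesis
    using v(1) id_map const_map
    by (auto simp: strongly_collapsible_def same_contiguity_class_def vertices_def)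
qed

subsection \<open>Connectivity\<close>

abbreviation joined :: "'a set set \<Rightarrow> 'a \<Rightarrow> 'a \<Rightarrow> bool" where
  "joined K \<equiv> (\<lambda>x y. {x, y} \<in> K)\<^sup>*\<^sup>*"

lemma joined_sym: "joined K x y \<Longrightarrow> joined K y x"
  by (rule sympD[OF symp_rtranclp]) (auto simp: symp_def insert_commute)

lemma joined_mono: "joined K x y \<Longrightarrow> K \<subseteq> L \<Longrightarrow> joined L x y"
  by (rule rtranclp_mono[THEN predicate2D, rotated]) auto

text \<open>A walk that starts inside \<open>P\<close> and ends outside crosses the boundary of
  \<open>P\<close> at some step. In the maximality arguments this supplies the edge to be
  added.\<close>

lemma joined_leaves:
  assumes "joined K u w" and "P u" and "\<not> P w"
  obtains a b where "{a, b} \<in> K" and "P a" and "\<not> P b"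
  using assms by (induction rule: rtranclp_induct) blast+

text \<open>A walk need cross the new edge at most once, because a second crossing returns it to
  \<open>a\<close> or \<open>b\<close>, both of which it has already visited.\<close>

lemma joined_insert_edge:
  assumes "joined (insert {a, b} K) x y"
  shows "joined K x y \<or> joined K x a \<and> joined K b y \<or> joined K x b \<and> joined K a y"
  using assms
proof (induction rule: rtranclp_induct)
  case base
  show ?case by simp
next
  case (step y z)
  show ?case
  proof (cases "{y, z} \<in> K")
    case True
    then show ?thesis using step.IH by (meson rtranclp.rtrancl_into_rtrancl)
  next
    case False
    then have "y = a \<and> z = b \<or> y = b \<and> z = a"
      using step.hyps by (auto simp: doubleton_eq_iff)
    then show ?thesis using step.IH by auto
  qed
qed

text \<open>Contiguous maps send a vertex to equal or adjacent vertices, so a chain from the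
  identity to a constant traces, for every vertex, a walk to one common vertex.\<close>

lemma strongly_collapsible_imp_joined:
  assumes K: "simplicial_complex K" "strongly_collapsible K"
    and xy: "x \<in> vertices K" "y \<in> vertices K"
  shows "joined K x y"
proof -
  obtain v where v: "(contiguous K K)\<^sup>*\<^sup>* (\<lambda>x. x) (\<lambda>_. v)"
    using K(2) by (auto simp: strongly_collapsible_def same_contiguity_class_def)
  have trace: "joined K (\<phi> z) (\<psi> z)"
    if "(contiguous K K)\<^sup>*\<^sup>* \<phi> \<psi>" "z \<in> vertices K" for \<phi> \<psi> z
    using that(1)
  proof (induction rule: rtranclp_induct)
    case (step \<psi> \<chi>)
    from step.hyps(2) singleton_in_complex[OF K(1) that(2)]
    have "\<psi> ` {z} \<union> \<chi> ` {z} \<in> K"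
      unfolding contiguous_def by blast
    then have "{\<psi> z, \<chi> z} \<in> K" by (simp add: insert_commute)
    with step.IH show ?case by (rule rtranclp.rtrancl_into_rtrancl)
  qed simp
  show ?thesis
    using trace[OF v xy(1)] joined_sym[OF trace[OF v xy(2)]] by (rule rtranclp_trans)
qed

subsection \<open>Cycles and bridges\<close>

text \<open>Acyclicity in terms of reachability, which is easier to maintain than vertex sequences
  when edges are added. The case \<open>x = y\<close> is left out because \<open>{x, x}\<close> is a
  vertex.\<close>

definition all_bridges :: "'a set set \<Rightarrow> bool" where
  "all_bridges K \<longleftrightarrow> (\<forall>x y. x \<noteq> y \<longrightarrow> {x, y} \<in> K \<longrightarrow> \<not> joined (K - {{x, y}}) x y)"

lemma cycle_edge:
  assumes "cycle G n v e" and "i \<in> {1..n}"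
  shows "e i \<in> edges G" and "e i = {v (i - 1), v i}"
proof -
  have *: "\<forall>i\<in>{1..n}. e i \<in> edges G \<and> e i = {v (i - 1), v i}"
    using assms(1) unfolding cycle_def by (elim conjE)
  show "e i \<in> edges G" using bspec[OF * assms(2)] by (rule conjunct1)
  show "e i = {v (i - 1), v i}" using bspec[OF * assms(2)] by (rule conjunct2)
qed

text \<open>The vertices of a cycle are ends of its edges, so edge sets are compared. This matters
  later, where a forest contains all vertices of the graph but a member of the cover may
  not.\<close>

lemma cycle_mono:
  assumes "cycle F n v e" and "edges F \<subseteq> edges G"
  shows "cycle G n v e"
proof -
  have e: "e i \<in> edges G \<and> e i = {v (i - 1), v i}" if "i \<in> {1..n}" for i
    using subsetD[OF assms(2) cycle_edge(1)[OF assms(1) that]] cycle_edge(2)[OF assms(1) that]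
    by (rule conjI)
  have n: "n \<ge> 1" "v 0 = v n"
    using assms(1) by (auto simp: cycle_def)
  have *: "v i \<in> vertices G" if "i \<in> {1..n}" for i
    using e[OF that] unfolding vertices_def edges_def by blast
  \<comment> \<open>Index 0 carries no edge, but \<open>v 0 = v n\<close> with
    \<open>n \<ge> 1\<close>.\<close>
  have "v i \<in> vertices G" if "i \<in> {0..n}" for i
    using that n *[of i] *[of n] by (cases "i = 0") auto
  with e assms(1) show ?thesis
    unfolding cycle_def by blast
qed

text \<open>A walk of minimal length repeats no vertex: the part between two visits could be cut
  out.\<close>

lemma shortest_path:
  assumes "r\<^sup>*\<^sup>* x y"
  obtains f :: "nat \<Rightarrow> 'a" and n where "f 0 = x" and "f n = y"
    and "\<And>i. i < n \<Longrightarrow> r (f i) (f (Suc i))" and "inj_on f {0..n}"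
proof -
  define n where "n = (LEAST n. (r ^^ n) x y)"
  have ex: "\<exists>n. (r ^^ n) x y" using assms by (simp add: rtranclp_power)
  have "(r ^^ n) x y"
    unfolding n_def using ex by (rule LeastI_ex)
  then obtain f where f: "f 0 = x" "f n = y" "\<And>i. i < n \<Longrightarrow> r (f i) (f (Suc i))"
    by (auto simp: relpowp_fun_conv)
  have False if ij: "i < j" "j \<le> n" "f i = f j" for i j
  proof -
    have "(r ^^ i) x (f i)"
      unfolding relpowp_fun_conv using f ij by (intro exI[of _ f]) auto
    moreover have "(r ^^ (n - j)) (f i) y"
      unfolding relpowp_fun_conv using f ij by (intro exI[of _ "\<lambda>k. f (j + k)"]) auto
    ultimately have "(r ^^ (i + (n - j))) x y"
      by (auto simp: relpowp_add)
    then have "n \<le> i + (n - j)"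
      unfolding n_def by (rule Least_le)
    with ij show False by simp
  qed
  then have "inj_on f {0..n}"
    by (intro linorder_inj_onI) auto
  with f show thesis by (rule that)
qed

text \<open>If an edge is not a bridge, a shortest walk between its ends that avoids it is closed to
  a cycle by that edge.\<close>

lemma no_cycle_imp_all_bridges:
  assumes "\<nexists>n v e. cycle K n v e"
  shows "all_bridges K"
  unfolding all_bridges_def
proof (intro allI impI notI)
  fix x y
  assume xy: "x \<noteq> y" "{x, y} \<in> K" and path: "joined (K - {{x, y}}) x y"
  obtain f n where f: "f 0 = x" "f n = y" "inj_on f {0..n}"
    and step: "\<And>i. i < n \<Longrightarrow> {f i, f (Suc i)} \<in> K - {{x, y}}"
    using shortest_path[OF path] by metis
  \<comment> \<open>The value \<open>x\<close> past the end of the path gives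
    \<open>v (Suc n) = v 0\<close>, so that \<open>e (Suc n)\<close> is the removed edge.\<close>
  define v where "v i = (if i \<le> n then f i else x)" for i
  define e where "e i = {v (i - 1), v i}" for i
  have n: "n \<ge> 1" using f xy by (cases n) auto
  have f_eq: "f i = f j \<longleftrightarrow> i = j" if "i \<le> n" "j \<le> n" for i j
    using f(3) that by (auto simp: inj_on_eq_iff)
  have e_last: "e (Suc n) = {x, y}"
    using f by (auto simp: e_def v_def)
  have e_path: "e i = {f (i - 1), f i}" "e i \<in> K - {{x, y}}" if "1 \<le> i" "i \<le> n" for i
  proof -
    show *: "e i = {f (i - 1), f i}" using that by (auto simp: e_def v_def)
    show "e i \<in> K - {{x, y}}"
      unfolding * using step[of "i - 1"] that by simp
  qed
  have edge: "e i \<in> edges K" if "i \<in> {1..Suc n}" for i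
  proof (cases "i = Suc n")
    case True
    then show ?thesis using e_last xy by (simp add: edges_def)
  next
    case False
    then have "1 \<le> i" "i \<le> n" using that by auto
    \<comment> \<open>A step of \<open>joined\<close> may stay in place, since \<open>{z, z}\<close>
      is a vertex; injectivity of the path excludes this.\<close>
    then have "f (i - 1) \<noteq> f i" using f_eq[of "i - 1" i] by simp
    then have "card (e i) = 2" using e_path(1)[OF \<open>1 \<le> i\<close> \<open>i \<le> n\<close>] by simp
    with e_path(2)[OF \<open>1 \<le> i\<close> \<open>i \<le> n\<close>] show ?thesis by (simp add: edges_def)
  qed
  \<comment> \<open>The path avoids \<open>{x, y}\<close>, so only the closing edge equals
    it.\<close>
  have last_only: "k = Suc n" if "e k = {x, y}" "k \<in> {1..Suc n}" for k
  proof (rule ccontr)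
    assume "k \<noteq> Suc n"
    then have "e k \<in> K - {{x, y}}" using that(2) by (intro e_path(2)) auto
    with that(1) show False by simp
  qed
  have "inj_on e {1..Suc n}"
  proof (rule inj_onI)
    fix i j assume i: "i \<in> {1..Suc n}" and j: "j \<in> {1..Suc n}" and eq: "e i = e j"
    show "i = j"
    proof (cases "i \<le> n \<and> j \<le> n")
      case True
      then have le: "i \<le> n" "j \<le> n" "i - 1 \<le> n" "j - 1 \<le> n" by auto
      have "1 \<le> i" "1 \<le> j" using i j by auto
      then have "{f (i - 1), f i} = {f (j - 1), f j}"
        using eq le(1,2) by (simp only: e_path(1))
      \<comment> \<open>Equal edges match in the same or in reversed order; reversal would need
        \<open>i - 1 = j\<close> and \<open>i = j - 1\<close>, impossible for
        \<open>i \<ge> 1\<close>.\<close>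
      then have "f (i - 1) = f (j - 1) \<and> i = j \<or> i - 1 = j \<and> i = j - 1"
        by (simp only: doubleton_eq_iff f_eq[OF le(1,2)] f_eq[OF le(3,2)] f_eq[OF le(1,4)])
      then show ?thesis using \<open>1 \<le> i\<close> by linarith
    next
      case False
      then have "i = Suc n \<or> j = Suc n" using i j by auto
      then have "e i = {x, y}" "e j = {x, y}" using eq e_last by metis+
      then have "i = Suc n" "j = Suc n" using last_only i j by blast+
      then show ?thesis by simp
    qed
  qed
  moreover have "inj_on v {0..<Suc n}"
    using f(3) by (auto simp: inj_on_def v_def)
  moreover have "v i \<in> vertices K" if "i \<in> {0..Suc n}" for i
  proof (cases "i = 0")
    case True
    then show ?thesis using f xy by (auto simp: v_def vertices_def)
  next
    case False
    then show ?thesis using edge[of i] that by (auto simp: edges_def e_def vertices_def)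
  qed
  moreover have "v 0 = v (Suc n)" using f by (simp add: v_def)
  moreover have "\<forall>i\<in>{1..Suc n}. e i \<in> edges K \<and> e i = {v (i - 1), v i}"
    using edge e_def by blast
  ultimately have "cycle K (Suc n) v e"
    unfolding cycle_def by (intro conjI) (assumption | simp)+
  with assms show False by blast
qed

text \<open>The new edge is a bridge because \<open>K\<close> does not connect its ends. An old edge
  stays one: a detour around it would have to use \<open>{a, b}\<close>, and the rest of the detour
  together with the old edge would join \<open>a\<close> to \<open>b\<close> in
  \<open>K\<close>.\<close>

lemma all_bridges_insert_edge:
  assumes K: "all_bridges K" and ab: "\<not> joined K a b"
  shows "all_bridges (insert {a, b} K)"
  unfolding all_bridges_def
proof (intro allI impI notI)
  fix x y
  assume xy: "x \<noteq> y" "{x, y} \<in> insert {a, b} K"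
    and path: "joined (insert {a, b} K - {{x, y}}) x y"
  show False
  proof (cases "{x, y} = {a, b}")
    case True
    then have "joined K x y"
      using joined_mono[OF path] by blast
    with True ab show False
      by (auto simp: doubleton_eq_iff dest: joined_sym)
  next
    case False
    let ?L = "K - {{x, y}}"
    have xyK: "{x, y} \<in> K" using xy False by auto
    then have nxy: "\<not> joined ?L x y" using K xy by (auto simp: all_bridges_def)
    have "insert {a, b} K - {{x, y}} = insert {a, b} ?L" using False by auto
    with path nxy have "joined ?L x a \<and> joined ?L b y \<or> joined ?L x b \<and> joined ?L a y"
      using joined_insert_edge[of a b ?L x y] by auto
    then have "joined K x a \<and> joined K b y \<or> joined K x b \<and> joined K a y"
      using joined_mono[of ?L _ _ K] by blast
    moreover have xy': "joined K x y" using xyK by blast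
    ultimately have "joined K a b"
    proof (elim disjE conjE)
      assume "joined K x a" "joined K b y"
      then show ?thesis
        using rtranclp_trans[OF rtranclp_trans[OF joined_sym xy'] joined_sym] by blast
    next
      assume "joined K x b" "joined K a y"
      then show ?thesis
        using rtranclp_trans[OF rtranclp_trans[OF _ joined_sym[OF xy']]] by blast
    qed
    with ab show False by blast
  qed
qed

section \<open>Rigidity of the inclusion on a cycle\<close>

text \<open>Length one would need a loop, and length two a repeated edge. The bound makes the two
  neighbours of each cycle vertex distinct.\<close>

lemma cycle_length_ge_3:
  assumes "cycle G n v e"
  shows "n \<ge> 3"
proof -
  have n: "n \<ge> 1" and v: "v 0 = v n" and e: "inj_on e {1..n}"
    using assms by (auto simp: cycle_def)
  have e_ends: "e i = {v (i - 1), v i}" "card (e i) = 2" if "i \<in> {1..n}" for i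
    using cycle_edge[OF assms that] by (simp_all only: edges_def mem_Collect_eq)
  have "n \<noteq> 1" using e_ends[of 1] v by auto
  moreover have "n \<noteq> 2"
  proof
    assume n: "n = 2"
    then have "e 1 = e 2" using e_ends[of 1] e_ends[of 2] v by auto
    with inj_onD[OF e, of 1 2] n show False by simp
  qed
  ultimately show ?thesis using n by linarith
qed

text \<open>The images under \<open>\<phi>\<close> and \<open>\<psi>\<close> of an edge with ends
  fixed by \<open>\<phi>\<close> form a simplex with at most two vertices, hence the edge itself. So
  \<open>\<psi> b\<close> lies in both \<open>{a, b}\<close> and \<open>{b, c}\<close>, which meet
  only in \<open>b\<close>.\<close>

lemma contiguous_id_fixes_branching:
  assumes "graph G" and "contiguous U G \<phi> \<psi>"
    and "{a, b} \<in> U" "{b, c} \<in> U" "a \<noteq> b" "b \<noteq> c" "a \<noteq> c"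
    and "\<phi> a = a" "\<phi> b = b" "\<phi> c = c"
  shows "\<psi> b = b"
proof -
  have *: "\<psi> b \<in> {p, q}" if "{p, q} \<in> U" "p \<noteq> q" "\<phi> p = p" "\<phi> q = q" "b \<in> {p, q}" for p q
  proof -
    let ?S = "\<phi> ` {p, q} \<union> \<psi> ` {p, q}"
    have "?S \<in> G"
      using assms(2) that by (auto simp: contiguous_def)
    then have S: "finite ?S" "card ?S \<le> 2"
      using assms(1) by (auto simp: graph_def)
    have "{p, q} \<subseteq> ?S" "card {p, q} = 2" using that by auto
    then have "{p, q} = ?S" using S by (intro card_seteq) auto
    then show ?thesis using that(5) by blast
  qed
  from *[of a b] *[of b c] assms show ?thesis by auto
qed

text \<open>Every map reached from the inclusion fixes all vertices of a cycle, so none of these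
  maps is constant.\<close>

lemma categorical_imp_no_cycle:
  assumes G: "graph G" and U: "categorical G U"
  shows "\<not> cycle U n v e"
proof
  assume C: "cycle U n v e"
  have n: "n \<ge> 3" using C by (rule cycle_length_ge_3)
  have v: "v 0 = v n" and inj: "inj_on v {0..<n}"
    using C by (auto simp: cycle_def)
  have v_eq: "v i = v j \<longleftrightarrow> i = j" if "i < n" "j < n" for i j
    using inj that by (auto simp: inj_on_eq_iff)
  have e': "{v i, v (Suc i)} \<in> U" if "i < n" for i
    using cycle_edge[OF C, of "Suc i"] that by (simp add: edges_def)
  obtain w where w: "(contiguous U G)\<^sup>*\<^sup>* (\<lambda>x. x) (\<lambda>_. w)"
    using U by (auto simp: categorical_def same_contiguity_class_def)
  have rigid: "\<forall>i<n. \<psi> (v i) = v i" if "(contiguous U G)\<^sup>*\<^sup>* (\<lambda>x. x) \<psi>" for \<psi>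
    using that
  proof (induction rule: rtranclp_induct)
    case (step \<phi> \<psi>)
    show ?case
    proof (intro allI impI)
      fix i assume i: "i < n"
      \<comment> \<open>\<open>a\<close> and \<open>c\<close> are the cyclic predecessor and
        successor of \<open>i\<close> among \<open>0, ..., n - 1\<close>; index \<open>n\<close>
        repeats index 0.\<close>
      define a where "a = (if i = 0 then n - 1 else i - 1)"
      define c where "c = (if Suc i = n then 0 else Suc i)"
      have ac: "a < n" "c < n" "a \<noteq> i" "i \<noteq> c" "a \<noteq> c"
        using i n by (auto simp: a_def c_def split: if_splits)
      have "{v a, v i} \<in> U" "{v i, v c} \<in> U"
        using e'[of a] e'[of i] i n v by (auto simp: a_def c_def split: if_splits)
      then show "\<psi> (v i) = v i"
        using contiguous_id_fixes_branching[OF G step.hyps(2), of "v a" "v i" "v c"]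
          step.IH ac i v_eq by auto
    qed
  qed simp
  have "w = v i" if "i < n" for i
    using rigid[OF w] that by blast
  from this[of 0] this[of 1] n have "v 0 = v 1" by simp
  with v_eq[of 0 1] n show False by auto
qed

subsection \<open>Trees\<close>

lemma simplicial_complex_insert_vertex:
  assumes "simplicial_complex K"
  shows "simplicial_complex (insert {b} K)"
proof -
  have "\<tau> = {b}" if "\<tau> \<subseteq> {b}" "\<tau> \<noteq> {}" for \<tau>
    using that by blast
  then show ?thesis
    using assms unfolding simplicial_complex_def by blast
qed

lemma simplicial_complex_insert_edge:
  assumes "simplicial_complex K" and "a \<in> vertices K" and "b \<in> vertices K"
  shows "simplicial_complex (insert {a, b} K)"
proof -
  have "{a} \<in> K" "{b} \<in> K" using assms by (auto intro: singleton_in_complex)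
  moreover have "\<tau> = {a} \<or> \<tau> = {b} \<or> \<tau> = {a, b}" if "\<tau> \<subseteq> {a, b}" "\<tau> \<noteq> {}" for \<tau>
    using that by blast
  ultimately show ?thesis
    using assms(1) unfolding simplicial_complex_def by blast
qed

lemma obtain_maximal_subset:
  assumes "finite B" and "P A" and "\<And>S. P S \<Longrightarrow> S \<subseteq> B"
  obtains S where "P S" and "\<And>R. P R \<Longrightarrow> S \<subseteq> R \<Longrightarrow> R = S"
proof -
  have "finite (Collect P)"
    by (rule finite_subset[of _ "Pow B"]) (use assms in auto)
  moreover have "Collect P \<noteq> {}" using assms(2) by auto
  ultimately have "\<exists>S\<in>Collect P. \<forall>R\<in>Collect P. S \<subseteq> R \<longrightarrow> S = R"
    by (rule finite_has_maximal)
  with that show thesis by (metis mem_Collect_eq)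
qed

text \<open>Take a maximal acyclic \<open>T\<close> between \<open>F\<close> and \<open>G\<close>.
  If it were disconnected, some edge of \<open>G\<close> would leave a component of
  \<open>T\<close>, and adding it would keep every edge a bridge.\<close>

lemma extend_to_spanning_tree:
  assumes G: "finite G" "connected_complex G"
    and F: "subcomplex F G" "all_bridges F" "vertices F = vertices G"
  obtains T where "F \<subseteq> T" "subcomplex T G" "all_bridges T" "connected_complex T"
proof -
  let ?P = "\<lambda>T. F \<subseteq> T \<and> subcomplex T G \<and> all_bridges T"
  obtain T where T: "?P T" and max: "\<And>S. ?P S \<Longrightarrow> T \<subseteq> S \<Longrightarrow> S = T"
    by (rule obtain_maximal_subset[of G ?P F]) (use G F in \<open>simp_all add: subcomplex_def\<close>)
  \<comment> \<open>As \<open>F\<close> spans \<open>G\<close>, the ends of any edge of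
    \<open>G\<close> are already vertices of \<open>T\<close>, so an edge can be inserted on its
    own.\<close>
  have VT: "vertices T = vertices G"
    using T F vertices_mono[of F T] vertices_mono[of T G] by (auto simp: subcomplex_def)
  have "joined T u w" if uw: "u \<in> vertices T" "w \<in> vertices T" for u w
  proof (rule ccontr)
    assume not: "\<not> joined T u w"
    have "joined G u w" using G uw VT by (auto simp: connected_complex_def)
    then obtain a b where ab: "{a, b} \<in> G" "joined T u a" "\<not> joined T u b"
      using joined_leaves[of G u w "joined T u"] not by blast
    then have nab: "\<not> joined T a b" by (meson rtranclp_trans)
    have "a \<in> vertices T" "b \<in> vertices T"
      using ab(1) VT by (auto simp: vertices_def)
    then have "subcomplex (insert {a, b} T) G"
      using T ab(1) simplicial_complex_insert_edge[of T a b] by (simp add: subcomplex_def)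
    moreover have "all_bridges (insert {a, b} T)"
      using T nab all_bridges_insert_edge[of T a b] by simp
    ultimately have "insert {a, b} T = T"
      using T by (intro max) auto
    then have "{a, b} \<in> T" by blast
    with nab show False by blast
  qed
  then have "connected_complex T" by (simp add: connected_complex_def)
  with T show thesis by (intro that[of T]) auto
qed

text \<open>A maximal strongly collapsible subcomplex \<open>S\<close> contains all vertices, as
  otherwise connectedness gives a leaf to attach. It contains all edges, since a missing one would
  be bypassed by a walk in the connected \<open>S\<close> and so not be a bridge.\<close>

lemma tree_strongly_collapsible:
  assumes T: "graph T" "finite T" "all_bridges T" "connected_complex T"
  shows "strongly_collapsible T"
proof -
  have TC: "simplicial_complex T" using T by (simp add: graph_def)
  let ?P = "\<lambda>S. subcomplex S T \<and> strongly_collapsible S"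
  obtain \<sigma> where \<sigma>: "\<sigma> \<in> T" using T by (auto simp: graph_def)
  have "?P (Pow \<sigma> - {{}})"
    using full_simplex_strongly_collapsible[of \<sigma>] subcomplex_full_simplex[OF TC \<sigma>]
      simplex_finite_nonempty[OF TC \<sigma>]
    by simp
  then obtain S where S: "?P S" and max: "\<And>R. ?P R \<Longrightarrow> S \<subseteq> R \<Longrightarrow> R = S"
    by (rule obtain_maximal_subset[OF T(2), of ?P]) (simp_all add: subcomplex_def)
  then have ST: "S \<subseteq> T" and SC: "simplicial_complex S" and coll: "strongly_collapsible S"
    by (simp_all add: subcomplex_def)
  have "vertices S \<subseteq> vertices T" using ST by (rule vertices_mono)
  moreover have "w \<in> vertices S" if w: "w \<in> vertices T" for w
  proof (rule ccontr)
    assume not: "w \<notin> vertices S"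
    obtain u where u: "u \<in> vertices S"
      using coll by (auto simp: strongly_collapsible_def)
    then have "joined T u w"
      using T(4) w \<open>vertices S \<subseteq> vertices T\<close> by (auto simp: connected_complex_def)
    then obtain a b where ab: "{a, b} \<in> T" "a \<in> vertices S" "b \<notin> vertices S"
      using joined_leaves[of T u w "\<lambda>x. x \<in> vertices S"] u not by blast
    let ?R = "S \<union> {{b}, {a, b}}"
    have b: "{b} \<in> T" using simplicial_complex_subset[OF TC ab(1), of "{b}"] by simp
    have "simplicial_complex (insert {b} S)"
      using SC by (rule simplicial_complex_insert_vertex)
    then have "simplicial_complex (insert {a, b} (insert {b} S))"
      using ab by (intro simplicial_complex_insert_edge) (auto simp: vertices_def)
    moreover have "insert {a, b} (insert {b} S) = ?R" by auto
    ultimately have "simplicial_complex ?R" by simp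
    moreover have "strongly_collapsible ?R"
      using SC coll ab(2,3) by (rule strongly_collapsible_add_leaf)
    ultimately have "?P ?R" using ST ab b by (simp add: subcomplex_def)
    then have "?R = S" by (rule max) auto
    then have "{b} \<in> S" by blast
    with ab(3) show False by (auto simp: vertices_def)
  qed
  ultimately have V: "vertices S = vertices T" by blast
  have "\<sigma> \<in> S" if \<sigma>: "\<sigma> \<in> T" for \<sigma>
  proof (rule ccontr)
    assume not: "\<sigma> \<notin> S"
    have vS: "x \<in> vertices S" if "x \<in> \<sigma>" for x
      using that \<sigma> V by (auto simp: vertices_def)
    from T(1) \<sigma> show False
    proof (cases rule: simplex_cases)
      case (1 x)
      then show False using not vS[of x] singleton_in_complex[OF SC, of x] by simp
    next
      case (2 x y)
      then have "joined S x y"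
        using vS by (intro strongly_collapsible_imp_joined[OF SC coll]) auto
      then have "joined (T - {{x, y}}) x y"
        by (rule joined_mono) (use ST not 2 in auto)
      then show False using T(3) 2 \<sigma> by (auto simp: all_bridges_def)
    qed
  qed
  then have "S = T" using ST by blast
  with coll show ?thesis by simp
qed

subsection \<open>Comparison of the covers\<close>

text \<open>This and the next two definitions name the predicates minimised in \<open>scat\<close>,
  \<open>gscat\<close> and \<open>arboricity\<close>, so that they can be compared for each
  size.\<close>

definition categorical_cover :: "'a set set \<Rightarrow> nat \<Rightarrow> bool" where
  "categorical_cover K n \<longleftrightarrow> (\<exists>U :: nat \<Rightarrow> 'a set set.
     (\<forall>i\<le>n. categorical K (U i)) \<and> K = (\<Union>i\<le>n. U i))"

definition collapsible_cover :: "'a set set \<Rightarrow> nat \<Rightarrow> bool" where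
  "collapsible_cover K n \<longleftrightarrow> (\<exists>U :: nat \<Rightarrow> 'a set set.
     (\<forall>i\<le>n. subcomplex (U i) K \<and> strongly_collapsible (U i)) \<and> K = (\<Union>i\<le>n. U i))"

definition forest_decomposition :: "'a set set \<Rightarrow> nat \<Rightarrow> bool" where
  "forest_decomposition G k \<longleftrightarrow> (\<exists>F :: nat \<Rightarrow> 'a set set.
     (\<forall>i<k. spanning_forest (F i) G) \<and>
     (\<forall>i<k. \<forall>j<k. i \<noteq> j \<longrightarrow> edges (F i) \<inter> edges (F j) = {}) \<and>
     G = (\<Union>i<k. F i))"

lemma collapsible_cover_imp_categorical_cover:
  "collapsible_cover K n \<Longrightarrow> categorical_cover K n"
  unfolding collapsible_cover_def categorical_cover_def
  using strongly_collapsible_imp_categorical by blast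

text \<open>Each simplex together with its faces is strongly collapsible, and there are finitely
  many of them.\<close>

lemma collapsible_cover_exists:
  assumes K: "simplicial_complex K" "finite K" "K \<noteq> {}"
  shows "\<exists>n. collapsible_cover K n"
proof -
  obtain f where f: "bij_betw f {0..<card K} K"
    using ex_bij_betw_nat_finite[OF K(2)] by blast
  have pos: "card K > 0" using K by (simp add: card_gt_0_iff)
  \<comment> \<open>Indices run from 0 to \<open>n\<close> inclusive, so \<open>card K\<close>
    members mean \<open>n = card K - 1\<close>.\<close>
  define n where "n = card K - 1"
  have "{0..<card K} = {..n}" using pos by (auto simp: n_def)
  with f have im: "f ` {..n} = K" by (simp add: bij_betw_def)
  define U where "U i = Pow (f i) - {{}}" for i
  have fK: "f i \<in> K" if "i \<le> n" for i
    using im that by auto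
  have U: "subcomplex (U i) K \<and> strongly_collapsible (U i)" and fU: "f i \<in> U i"
    if "i \<le> n" for i
    using full_simplex_strongly_collapsible[of "f i"] subcomplex_full_simplex[OF K(1) fK[OF that]]
      simplex_finite_nonempty[OF K(1) fK[OF that]]
    by (simp_all add: U_def)
  have "K \<subseteq> (\<Union>i\<le>n. U i)"
    using fU im by blast
  moreover have "(\<Union>i\<le>n. U i) \<subseteq> K"
    using U by (intro UN_least) (simp add: subcomplex_def)
  ultimately have "K = (\<Union>i\<le>n. U i)"
    by (rule subset_antisym)
  with U have "collapsible_cover K n"
    unfolding collapsible_cover_def by blast
  then show ?thesis ..
qed

text \<open>Members of a categorical cover have no cycles, and dropping edges creates none. Hence
  each edge may be assigned to the first member that contains it.\<close>

lemma categorical_cover_imp_forest_decomposition: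
  assumes G: "graph G" and "categorical_cover G n"
  shows "forest_decomposition G (Suc n)"
proof -
  obtain U :: "nat \<Rightarrow> 'a set set" where U: "\<And>i. i \<le> n \<Longrightarrow> categorical G (U i)"
    and cov: "G = (\<Union>i\<le>n. U i)"
    using assms(2) by (auto simp: categorical_cover_def)
  have GC: "simplicial_complex G" using G by (simp add: graph_def)
  \<comment> \<open>Including all vertices makes \<open>F i\<close> spanning; removing earlier edges
    makes the pieces edge-disjoint.\<close>
  define F where "F i = {{x} | x. x \<in> vertices G} \<union> (edges (U i) - (\<Union>j<i. edges (U j)))" for i
  have sub: "U i \<subseteq> G" if "i \<le> n" for i
    using U[OF that] by (simp add: categorical_def subcomplex_def)
  have single: "{x} \<in> G" if "x \<in> vertices G" for x
    using GC that by (rule singleton_in_complex)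
  have edges_F: "edges (F i) = edges (U i) - (\<Union>j<i. edges (U j))" for i
    by (auto simp: F_def edges_def)
  have FG: "F i \<subseteq> G" if "i \<le> n" for i
    using sub[OF that] single by (auto simp: F_def edges_def)
  have FC: "simplicial_complex (F i)" if "i \<le> n" for i
    unfolding simplicial_complex_def
  proof (intro ballI conjI allI impI)
    fix \<sigma> assume \<sigma>: "\<sigma> \<in> F i"
    then have \<sigma>G: "\<sigma> \<in> G" using FG that by blast
    then show "finite \<sigma>" "\<sigma> \<noteq> {}" using simplex_finite_nonempty[OF GC] by auto
    fix \<tau> assume \<tau>: "\<tau> \<subseteq> \<sigma> \<and> \<tau> \<noteq> {}"
    have "\<tau> = \<sigma> \<or> (\<exists>x\<in>\<sigma>. \<tau> = {x})"
      by (rule simplex_cases[OF G \<sigma>G]) (use \<tau> in blast)+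
    then show "\<tau> \<in> F i"
      using \<sigma> \<sigma>G by (auto simp: F_def vertices_def)
  qed
  have VF: "vertices (F i) = vertices G" if "i \<le> n" for i
    using vertices_mono[OF FG[OF that]] by (auto simp: F_def vertices_def)
  have "spanning_forest (F i) G" if i: "i \<le> n" for i
  proof -
    have "\<not> cycle (F i) m v e" for m v e
      using categorical_imp_no_cycle[OF G U[OF i]] cycle_mono[of "F i" m v e "U i"] edges_F[of i]
      by blast
    moreover have "F i \<noteq> {}"
      using VF[OF i] G simplex_finite_nonempty[OF GC] by (auto simp: vertices_def graph_def)
    ultimately show ?thesis
      using FC[OF i] FG[OF i] VF[OF i] G
      by (auto simp: spanning_forest_def subcomplex_def forest_def graph_def)
  qed
  moreover have "edges (F i) \<inter> edges (F j) = {}" if "i \<noteq> j" for i j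
    using that unfolding edges_F by (cases "i < j") (auto simp: not_less le_less)
  moreover have "\<sigma> \<in> (\<Union>i\<le>n. F i)" if \<sigma>: "\<sigma> \<in> G" for \<sigma>
    using G \<sigma>
  proof (cases rule: simplex_cases)
    case (1 x)
    then show ?thesis using \<sigma> by (auto simp: F_def vertices_def)
  next
    case (2 x y)
    define i where "i = (LEAST i. \<sigma> \<in> edges (U i))"
    obtain k where k: "k \<le> n" "\<sigma> \<in> edges (U k)"
      using \<sigma> cov 2 by (auto simp: edges_def)
    then have "\<sigma> \<in> edges (U i)" "i \<le> k"
      unfolding i_def by (auto intro: LeastI Least_le)
    moreover have "\<sigma> \<notin> edges (U j)" if "j < i" for j
      using that unfolding i_def by (rule not_less_Least)
    ultimately show ?thesis using k by (auto simp: F_def intro!: exI[of _ i])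
  qed
  then have "G = (\<Union>i\<le>n. F i)" using FG by blast
  ultimately show ?thesis
    unfolding forest_decomposition_def less_Suc_eq_le lessThan_Suc_atMost by blast
qed

text \<open>Spanning trees that contain the forests still cover \<open>G\<close>. They may share
  edges, which a cover allows.\<close>

lemma forest_decomposition_imp_collapsible_cover:
  assumes G: "graph G" "finite G" "connected_complex G"
    and "forest_decomposition G (Suc n)"
  shows "collapsible_cover G n"
proof -
  obtain F :: "nat \<Rightarrow> 'a set set" where F: "\<And>i. i \<le> n \<Longrightarrow> spanning_forest (F i) G"
    and cov: "G = (\<Union>i\<le>n. F i)"
    using assms(4)
    unfolding forest_decomposition_def less_Suc_eq_le lessThan_Suc_atMost by blast
  have "\<exists>T. F i \<subseteq> T \<and> subcomplex T G \<and> strongly_collapsible T" if "i \<le> n" for i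
  proof -
    have Fi: "subcomplex (F i) G" "all_bridges (F i)" "vertices (F i) = vertices G" "F i \<noteq> {}"
      using F[OF that] no_cycle_imp_all_bridges[of "F i"]
      by (auto simp: spanning_forest_def forest_def graph_def)
    obtain T where T: "F i \<subseteq> T" "subcomplex T G" "all_bridges T" "connected_complex T"
      using extend_to_spanning_tree[OF G(2,3) Fi(1-3)] by blast
    have "graph T" "finite T"
      using T(1,2) Fi(4) G(1,2) finite_subset[of T G] by (auto simp: graph_def subcomplex_def)
    with T show ?thesis using tree_strongly_collapsible by blast
  qed
  then obtain T
    where T: "\<And>i. i \<le> n \<Longrightarrow> F i \<subseteq> T i \<and> subcomplex (T i) G \<and> strongly_collapsible (T i)"
    by metis
  have "(\<Union>i\<le>n. F i) \<subseteq> (\<Union>i\<le>n. T i)"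
    using T by (intro UN_mono) auto
  moreover have "(\<Union>i\<le>n. T i) \<subseteq> G"
    using T by (intro UN_least) (simp add: subcomplex_def)
  ultimately have "G = (\<Union>i\<le>n. T i)"
    using cov by blast
  with T show ?thesis
    unfolding collapsible_cover_def by blast
qed

theorem corollary8p3p2:
  fixes G :: "'a set set"
  assumes "graph G" and "finite G" and "connected_complex G"
  shows "scat G = gscat G \<and> int (gscat G) = int (arboricity G) - 1"
proof -
  \<comment> \<open>The implications run in a circle: collapsible cover, categorical cover, forest
    decomposition, collapsible cover. The bound \<open>n\<close> stands for \<open>n + 1\<close>
    members, hence \<open>Suc n\<close> forests.\<close>
  have cat: "categorical_cover G n \<longleftrightarrow> collapsible_cover G n"
    and arb: "collapsible_cover G n \<longleftrightarrow> forest_decomposition G (Suc n)" for n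
    using assms collapsible_cover_imp_categorical_cover categorical_cover_imp_forest_decomposition
      forest_decomposition_imp_collapsible_cover by blast+
  have s: "scat G = (LEAST n. categorical_cover G n)"
    by (simp add: scat_def categorical_cover_def)
  have g: "gscat G = (LEAST n. collapsible_cover G n)"
    by (simp add: gscat_def collapsible_cover_def)
  have a: "arboricity G = (LEAST k. forest_decomposition G k)"
    by (simp add: arboricity_def forest_decomposition_def)
  obtain n where "forest_decomposition G (Suc n)"
    using collapsible_cover_exists[of G] assms arb by (auto simp: graph_def)
  \<comment> \<open>A graph is nonempty, so zero forests cannot cover it, and the two minima differ
    by exactly one.\<close>
  moreover have "\<not> forest_decomposition G 0"
    using assms(1) by (auto simp: forest_decomposition_def graph_def)
  ultimately have "arboricity G = Suc (LEAST n. forest_decomposition G (Suc n))"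
    unfolding a by (rule Least_Suc)
  then show ?thesis
    using s g by (simp add: cat arb)
qed

end
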